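(* Assume that the sequence $\{e^{-k^2}\}_{k=0}^\infty$ is a real-to-tropical root preserver, i.e. that for every positive integer $d$ the finite sequence $\{e^{-k^2}\}_{0\le k\le d}$ is a degree $d$ real-to-tropical root preserver. Then the sequence $\{e^{-k^\alpha}\}_{k=0}^\infty$ is a complex zero decreasing sequence (CZDS) for all real $\alpha\ge3$.
   Context: Tropical indices and essential roots. Let $\{\lambda_{k,d}\}_{0\le k\le d}$ be positive numbers and $P(x)=\sum_{k=0}^d a_kx^k$ a real polynomial of degree $d$. The $\lambda$-tropicalization of $P$ is $tr_P^\lambda(\xi)=\max_{0\le k\le d}(k\xi+\ln|a_k|+\ln\lambda_{k,d})$ (terms with $a_k=0$ are ignored). Its tropical indices $k_0<\dots<k_m$ are the integers $k\in\{0,\dots,d\}$ for which there is $x>0$ with $\lambda_{k,d}|a_k|x^k\ge\max_{i\ne k}\lambda_{i,d}|a_i|x^i$. The number of essential tropical roots of $tr_P^\lambda$ is the number of sign alternations in $\{\mathrm{sgn}(a_{k_i})\}_{0\le i\le m}$ plus the number of sign alternations in $\{\mathrm{sgn}((-1)^{k_i}a_{k_i})\}_{0\le i\le m}$. A sequence $\{\lambda_{k,d}\}_{0\le k\le d}$ of positive numbers is a degree $d$ real-to-tropical root preserver if for every real polynomial $P$ of degree $d$ the number of essential tropical roots of $tr_P^\lambda$ is at least the number of non-zero real roots of $P$. CZDS. A sequence $\{\lambda_k\}_{k=0}^d$ of real numbers is a CZDS in degree $d$ if for any polynomial $P=a_0+a_1x+\dots+a_dx^d$ with real coefficients, the polynomial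 $\lambda_0a_0+\lambda_1a_1x+\dots+\lambda_da_dx^d$ has no more non-real roots than $P$. A sequence $\{\lambda_k\}_{k=0}^\infty$ is a CZDS if for every $d\in\mathbb{N}$ the sequence $\{\lambda_k\}_{k=0}^d$ is a CZDS in degree $d$. Real and non-real roots are counted with multiplicity. *)

theory Defs
  imports "HOL-Computational_Algebra.Fundamental_Theorem_Algebra"
begin

text \<open>
  A finite sequence indexed by \<open>0, \<dots>, d\<close> is represented by a function on \<open>nat\<close> of which only
  the values at \<open>k \<le> d\<close> are used. Roots are counted with multiplicity throughout; the zero
  polynomial has \<open>proots 0 = {#}\<close>, hence no counted roots.
\<close>

text \<open>
  Dominating the maximum over \<open>i \<noteq> k\<close> is spelled out term by term, since for \<open>d = 0\<close> there is
  no such \<open>i\<close>.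
\<close>
definition tropical_indices :: "(nat \<Rightarrow> real) \<Rightarrow> real poly \<Rightarrow> nat set" where
  "tropical_indices lam P =
     {k \<in> {0..degree P}. \<exists>x>0. \<forall>i\<in>{0..degree P} - {k}.
        lam i * \<bar>coeff P i\<bar> * x ^ i \<le> lam k * \<bar>coeff P k\<bar> * x ^ k}"

text \<open>
  Consecutive entries of opposite signs; this is only used for lists of non-zero numbers, see
  \<open>coeff_tropical_index_neq_0\<close> below.
\<close>
definition sign_alternations :: "real list \<Rightarrow> nat" where
  "sign_alternations xs = card {i. Suc i < length xs \<and> xs ! i * xs ! Suc i < 0}"

definition num_essential_tropical_roots :: "(nat \<Rightarrow> real) \<Rightarrow> real poly \<Rightarrow> nat" where
  "num_essential_tropical_roots lam P =
     (let ks = sorted_list_of_set (tropical_indices lam P) in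
        sign_alternations (map (\<lambda>k. sgn (coeff P k)) ks) +
        sign_alternations (map (\<lambda>k. sgn ((- 1) ^ k * coeff P k)) ks))"

definition num_nonzero_real_roots :: "real poly \<Rightarrow> nat" where
  "num_nonzero_real_roots P = size (filter_mset (\<lambda>x. x \<noteq> 0) (proots P))"

definition num_nonreal_roots :: "real poly \<Rightarrow> nat" where
  "num_nonreal_roots P =
     size (filter_mset (\<lambda>z. z \<notin> \<real>) (proots (map_poly complex_of_real P)))"

definition real_to_tropical_root_preserver :: "nat \<Rightarrow> (nat \<Rightarrow> real) \<Rightarrow> bool" where
  "real_to_tropical_root_preserver d lam \<longleftrightarrow>
     (\<forall>k\<le>d. lam k > 0) \<and>
     (\<forall>P. P \<noteq> 0 \<and> degree P = d \<longrightarrow>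
        num_nonzero_real_roots P \<le> num_essential_tropical_roots lam P)"

text \<open>The leading coefficient \<open>a\<^sub>d\<close> may vanish, so \<open>P\<close> ranges over all polynomials of degree at most \<open>d\<close>.\<close>
definition czds_in_degree :: "nat \<Rightarrow> (nat \<Rightarrow> real) \<Rightarrow> bool" where
  "czds_in_degree d lam \<longleftrightarrow>
     (\<forall>P. degree P \<le> d \<longrightarrow>
        num_nonreal_roots (\<Sum>k\<le>d. monom (lam k * coeff P k) k) \<le> num_nonreal_roots P)"

definition czds :: "(nat \<Rightarrow> real) \<Rightarrow> bool" where
  "czds lam \<longleftrightarrow> (\<forall>d. czds_in_degree d lam)"

lemma finite_tropical_indices: "finite (tropical_indices lam P)"
  by (simp add: tropical_indices_def)

lemma coeff_tropical_index_neq_0: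
  assumes "P \<noteq> 0" "\<And>k. k \<le> degree P \<Longrightarrow> lam k > 0" "k \<in> tropical_indices lam P"
  shows "coeff P k \<noteq> 0"
proof
  assume z: "coeff P k = 0"
  then have "k \<noteq> degree P"
    using assms(1) by auto
  then obtain x where x: "x > 0"
    and "lam (degree P) * \<bar>lead_coeff P\<bar> * x ^ degree P \<le> lam k * \<bar>coeff P k\<bar> * x ^ k"
    using assms(3) by (force simp: tropical_indices_def)
  moreover have "lam (degree P) * \<bar>lead_coeff P\<bar> * x ^ degree P > 0"
    using assms(1,2) x by simp
  ultimately show False
    using z by simp
qed

end

theory Submission
  imports Defs
begin

text \<open>
  Write \<open>e^(-k^\<alpha>) = e^(-k^2) e^(-f(k))\<close> with \<open>f(k) = k^\<alpha> - k^2\<close>, and let \<open>Q = \<Sum> e^(-k^\<alpha>) a\<^sub>k x^k\<close> for a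
  polynomial \<open>P = \<Sum> a\<^sub>k x^k\<close>. Since \<open>P\<close> and \<open>Q\<close> have the same degree and the same order of
  vanishing at \<open>0\<close>, it suffices that \<open>Q\<close> has at least as many non-zero real roots as \<open>P\<close>. The
  root preserver hypothesis bounds the number of those of \<open>P\<close> by the number of essential tropical
  roots of \<open>P\<close> for the weights \<open>e^(-k^2)\<close>, so what remains is to find that many real roots of \<open>Q\<close>.

  For \<open>\<alpha> \<ge> 3\<close> the second differences of \<open>f\<close> are at least \<open>6 - 2 = 4\<close>
  (\<open>second_difference_powr_ge\<close>). Hence through each point \<open>(k, f k)\<close> there is a line of some slope
  \<open>s\<close> with \<open>f(i) \<ge> f(k) + s(i - k) + 2|i - k|\<close> for all \<open>i\<close> (\<open>strongly_convex_seq_support_line\<close>). If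
  \<open>k\<close> is a tropical index of \<open>P\<close> at the point \<open>x\<close>, then at \<open>y = x e^s\<close> the \<open>i\<close>-th term of \<open>Q\<close> is at
  most \<open>e^(-2|i - k|)\<close> times its \<open>k\<close>-th term, in absolute value. As
  \<open>\<Sum>\<^bsub>i \<noteq> k\<^esub> e^(-2|i - k|) < 1\<close>, the \<open>k\<close>-th term outweighs all the others together
  (\<open>tropical_index_dominant_at\<close>) and determines the signs of \<open>Q(y)\<close> and \<open>Q(-y)\<close>. The points
  \<open>y\<close> increase with \<open>k\<close>, so by the intermediate value theorem every sign alternation along the
  tropical indices yields its own real root of \<open>Q\<close>, positive for the alternations of \<open>a\<^sub>k\<close> and
  negative for those of \<open>(-1)^k a\<^sub>k\<close> (\<open>alternations_le_num_nonzero_real_roots\<close>).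
\<close>

section \<open>Non-real roots of a real polynomial\<close>

lemma poly_map_poly_of_real:
  "poly (map_poly complex_of_real P) (complex_of_real x) = complex_of_real (poly P x)"
  by (simp add: poly_altdef degree_map_poly coeff_map_poly)

text \<open>
  The real roots of the complexification are the roots of \<open>P\<close>, with the same multiplicities; linear
  factors over \<open>\<real>\<close> are split off one at a time.
\<close>
lemma real_proots_map_poly_of_real:
  assumes "P \<noteq> 0"
  shows "filter_mset (\<lambda>z. z \<in> \<real>) (proots (map_poly complex_of_real P)) =
         image_mset complex_of_real (proots P)"
  using assms
proof (induction "degree P" arbitrary: P rule: less_induct)
  case less
  have nz: "map_poly complex_of_real R \<noteq> 0" if "R \<noteq> 0" for R
    using that by (metis coeff_0 coeff_map_poly leading_coeff_0_iff of_real_0 of_real_eq_0_iff)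
  show ?case
  proof (cases "\<exists>a. poly P a = 0")
    case True
    then obtain a where "poly P a = 0" by blast
    then obtain R where P: "P = [:- a, 1:] * R"
      by (metis poly_eq_0_iff_dvd dvdE)
    with less.prems have R: "R \<noteq> 0" by auto
    have "degree P = Suc (degree R)"
      unfolding P by (subst degree_mult_eq) (use R in auto)
    then have IH: "filter_mset (\<lambda>z. z \<in> \<real>) (proots (map_poly complex_of_real R)) =
        image_mset complex_of_real (proots R)"
      using less.hyps[of R] R by simp
    have "map_poly complex_of_real P =
        [:- complex_of_real a, 1:] * map_poly complex_of_real R"
      unfolding P
      by (intro poly_eqI) (simp add: coeff_map_poly coeff_pCons split: nat.splits)
    then have "proots (map_poly complex_of_real P) =
        add_mset (complex_of_real a) (proots (map_poly complex_of_real R))"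
      using nz[OF R] by (simp add: proots_mult del: mult_pCons_left)
    moreover have "proots P = add_mset a (proots R)"
      unfolding P using R by (simp add: proots_mult del: mult_pCons_left)
    ultimately show ?thesis using IH by simp
  next
    case False
    have "set_mset (proots P) = {}"
      using False less.prems by simp
    then have "proots P = {#}" by simp
    moreover have "z \<notin> \<real>" if "z \<in># proots (map_poly complex_of_real P)" for z
    proof
      assume "z \<in> \<real>"
      then obtain x where "z = complex_of_real x" by (auto elim: Reals_cases)
      with that show False
        using False nz[OF less.prems] by (simp add: poly_map_poly_of_real)
    qed
    ultimately show ?thesis by (auto simp: filter_mset_eq_conv)
  qed
qed

lemma num_nonreal_roots_add_size_proots:
  assumes "P \<noteq> 0"
  shows "num_nonreal_roots P + size (proots P) = degree P"
proof -
  let ?M = "proots (map_poly complex_of_real P)"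
  have "size ?M = degree P"
    by (simp add: size_proots_complex degree_map_poly)
  moreover have "size ?M = size (filter_mset (\<lambda>z. z \<in> \<real>) ?M) + size (filter_mset (\<lambda>z. z \<notin> \<real>) ?M)"
    by (metis multiset_partition size_union)
  ultimately show ?thesis
    using real_proots_map_poly_of_real[OF assms] by (simp add: num_nonreal_roots_def)
qed

lemma size_proots_eq_order_0:
  assumes "P \<noteq> 0"
  shows "size (proots P) = order 0 P + num_nonzero_real_roots P"
proof -
  have "size (proots P) = size (filter_mset (\<lambda>x. x = 0) (proots P)) +
      size (filter_mset (\<lambda>x. x \<noteq> 0) (proots P))"
    by (metis multiset_partition size_union)
  moreover have "filter_mset (\<lambda>x. x = 0) (proots P) = replicate_mset (order 0 P) 0"
    using assms by (simp add: filter_eq_replicate_mset)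
  ultimately show ?thesis by (simp add: num_nonzero_real_roots_def)
qed

lemma card_nonzero_roots_le:
  assumes "P \<noteq> 0"
  shows "card {x. x \<noteq> 0 \<and> poly P x = 0} \<le> num_nonzero_real_roots P"
proof -
  have "size (mset_set {x. x \<noteq> 0 \<and> poly P x = 0}) \<le>
      size (filter_mset (\<lambda>x. x \<noteq> 0) (proots P))"
  proof (rule size_mset_mono, rule mset_subset_eqI)
    fix x
    have "finite {x. x \<noteq> 0 \<and> poly P x = 0}"
      using poly_roots_finite[OF assms] by (rule rev_finite_subset) auto
    then show "count (mset_set {x. x \<noteq> 0 \<and> poly P x = 0}) x \<le>
        count (filter_mset (\<lambda>x. x \<noteq> 0) (proots P)) x"
      using assms order_root[of P x] by (auto simp: count_mset_set' Suc_le_eq)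
  qed
  then show ?thesis by (simp add: num_nonzero_real_roots_def)
qed

section \<open>Sign alternations and roots\<close>

lemma sign_alternations_cong_sgn:
  assumes "map sgn xs = map sgn ys"
  shows "sign_alternations xs = sign_alternations ys"
proof -
  have len: "length xs = length ys"
    using assms by (metis length_map)
  have "xs ! i * xs ! Suc i < 0 \<longleftrightarrow> ys ! i * ys ! Suc i < 0" if "Suc i < length xs" for i
  proof -
    have "sgn (xs ! i) = sgn (ys ! i)" "sgn (xs ! Suc i) = sgn (ys ! Suc i)"
      using assms that len by (metis nth_map Suc_lessD)+
    then have "sgn (xs ! i * xs ! Suc i) = sgn (ys ! i * ys ! Suc i)"
      by (simp add: sgn_mult)
    then show ?thesis by (metis sgn_less)
  qed
  then show ?thesis
    unfolding sign_alternations_def using len by (metis (no_types, lifting))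
qed

lemma sign_alternations_le_card_roots:
  fixes ys :: "real list"
  assumes sorted: "sorted_wrt (<) ys" and pos: "\<And>y. y \<in> set ys \<Longrightarrow> 0 < y" and "Q \<noteq> 0"
  shows "sign_alternations (map (poly Q) ys) \<le> card {x. 0 < x \<and> poly Q x = 0}"
proof -
  let ?I = "{i. Suc i < length ys \<and> poly Q (ys ! i) * poly Q (ys ! Suc i) < 0}"
  have "\<exists>x. ys ! i < x \<and> x < ys ! Suc i \<and> poly Q x = 0" if "i \<in> ?I" for i
  proof -
    have "ys ! i < ys ! Suc i"
      using that sorted by (auto simp: sorted_wrt_nth_less)
    then show ?thesis
      using poly_IVT[of "ys ! i" "ys ! Suc i" Q] that by blast
  qed
  then obtain r where r: "\<And>i. i \<in> ?I \<Longrightarrow> ys ! i < r i \<and> r i < ys ! Suc i \<and> poly Q (r i) = 0"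
    by metis
  have r_less: "r i < r j" if "i \<in> ?I" "j \<in> ?I" "i < j" for i j
  proof -
    have "ys ! Suc i \<le> ys ! j"
      using that sorted by (cases "Suc i = j") (auto intro!: less_imp_le simp: sorted_wrt_nth_less)
    then show ?thesis using r[OF that(1)] r[OF that(2)] by linarith
  qed
  have "inj_on r ?I"
    proof (rule inj_onI)
    fix i j assume "i \<in> ?I" "j \<in> ?I" "r i = r j"
    then show "i = j"
      using r_less[of i j] r_less[of j i] by (cases i j rule: linorder_cases) auto
  qed
  moreover have "r ` ?I \<subseteq> {x. 0 < x \<and> poly Q x = 0}"
  proof
    fix x assume "x \<in> r ` ?I"
    then obtain i where i: "i \<in> ?I" "x = r i" by blast
    moreover have "0 < ys ! i" using i(1) by (intro pos) auto
    ultimately show "x \<in> {x. 0 < x \<and> poly Q x = 0}" using r[OF i(1)] by auto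
  qed
  moreover have "finite {x. 0 < x \<and> poly Q x = 0}"
    using poly_roots_finite[OF \<open>Q \<noteq> 0\<close>] by (rule rev_finite_subset) auto
  ultimately have "card ?I \<le> card {x. 0 < x \<and> poly Q x = 0}"
    by (rule card_inj_on_le)
  moreover have "sign_alternations (map (poly Q) ys) = card ?I"
    unfolding sign_alternations_def by (intro arg_cong[where f = card]) auto
  ultimately show ?thesis by simp
qed

section \<open>Dominant monomials\<close>

text \<open>
  At the radius \<open>y > 0\<close> the monomial of degree \<open>k\<close> strictly outweighs the sum of all the others;
  in particular its coefficient is non-zero.
\<close>
definition dominant_at :: "real poly \<Rightarrow> nat \<Rightarrow> real \<Rightarrow> bool" where
  "dominant_at Q k y \<longleftrightarrow> 0 < y \<and> k \<le> degree Q \<and>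
     (\<Sum>i\<in>{..degree Q} - {k}. \<bar>coeff Q i\<bar> * y ^ i) < \<bar>coeff Q k\<bar> * y ^ k"

lemma sgn_poly_dominant_at:
  assumes "dominant_at Q k y" "\<bar>x\<bar> = y"
  shows "sgn (poly Q x) = sgn (coeff Q k * x ^ k)"
proof -
  let ?r = "\<Sum>i\<in>{..degree Q} - {k}. coeff Q i * x ^ i"
  have "poly Q x = coeff Q k * x ^ k + ?r"
    unfolding poly_altdef using assms(1) by (intro sum.remove) (auto simp: dominant_at_def)
  moreover have "\<bar>?r\<bar> \<le> (\<Sum>i\<in>{..degree Q} - {k}. \<bar>coeff Q i\<bar> * y ^ i)"
    using sum_abs[of "\<lambda>i. coeff Q i * x ^ i" "{..degree Q} - {k}"] assms(2)
    by (simp add: abs_mult power_abs)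
  then have "\<bar>?r\<bar> < \<bar>coeff Q k * x ^ k\<bar>"
    using assms by (simp add: dominant_at_def abs_mult power_abs)
  moreover have "sgn (a + r) = sgn a" if "\<bar>r\<bar> < \<bar>a\<bar>" for a r :: real
    using that by (auto simp: sgn_if)
  ultimately show ?thesis by simp
qed

lemma dominant_at_less:
  assumes "dominant_at Q k y" "i \<le> degree Q" "i \<noteq> k"
  shows "\<bar>coeff Q i\<bar> * y ^ i < \<bar>coeff Q k\<bar> * y ^ k"
proof -
  have "\<bar>coeff Q i\<bar> * y ^ i \<le> (\<Sum>i\<in>{..degree Q} - {k}. \<bar>coeff Q i\<bar> * y ^ i)"
    using assms by (intro member_le_sum) (auto simp: dominant_at_def)
  then show ?thesis using assms(1) by (simp add: dominant_at_def)
qed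

text \<open>
  Two dominant monomials compare in opposite ways at \<open>y\<close> and at \<open>z\<close>, and the one of higher degree
  gains as the radius grows.
\<close>
lemma dominant_at_mono:
  assumes k: "dominant_at Q k y" and l: "dominant_at Q l z" and "k < l"
  shows "y < z"
proof (rule ccontr)
  assume "\<not> y < z"
  then have zy: "0 < z" "z \<le> y" using l by (auto simp: dominant_at_def)
  have a: "\<bar>coeff Q l\<bar> * y ^ l < \<bar>coeff Q k\<bar> * y ^ k"
    using dominant_at_less[OF k, of l] l \<open>k < l\<close> by (auto simp: dominant_at_def)
  have b: "\<bar>coeff Q k\<bar> * z ^ k < \<bar>coeff Q l\<bar> * z ^ l"
    using dominant_at_less[OF l, of k] k \<open>k < l\<close> by (auto simp: dominant_at_def)
  define j where "j = l - k"
  have l_eq: "l = k + j" using \<open>k < l\<close> by (simp add: j_def)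
  have "\<bar>coeff Q l\<bar> * y ^ j < \<bar>coeff Q k\<bar>"
    using a zy unfolding l_eq power_add by (simp add: mult.left_commute[of _ "y ^ k"] mult.commute[of _ "y ^ k"])
  moreover have "\<bar>coeff Q k\<bar> < \<bar>coeff Q l\<bar> * z ^ j"
    using b zy unfolding l_eq power_add by (simp add: mult.left_commute[of _ "z ^ k"] mult.commute[of _ "z ^ k"])
  moreover have "\<bar>coeff Q l\<bar> * z ^ j \<le> \<bar>coeff Q l\<bar> * y ^ j"
    using zy by (intro mult_left_mono power_mono) auto
  ultimately show False by linarith
qed

lemma alternations_le_num_nonzero_real_roots:
  assumes "Q \<noteq> 0" and sorted: "sorted_wrt (<) ks"
    and dom: "\<And>k. k \<in> set ks \<Longrightarrow> \<exists>y. dominant_at Q k y"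
  shows "sign_alternations (map (coeff Q) ks) + sign_alternations (map (\<lambda>k. (- 1) ^ k * coeff Q k) ks)
    \<le> num_nonzero_real_roots Q"
proof -
  obtain y where y: "\<And>k. k \<in> set ks \<Longrightarrow> dominant_at Q k (y k)"
    using dom by metis
  have y_pos: "0 < y k" if "k \<in> set ks" for k
    using y[OF that] by (simp add: dominant_at_def)
  have sorted_y: "sorted_wrt (<) (map y ks)"
    unfolding sorted_wrt_map
    by (rule sorted_wrt_mono_rel[OF _ sorted]) (auto intro: dominant_at_mono y)
  \<comment> \<open>Negative roots of \<open>Q\<close> are positive roots of \<open>Q(-x)\<close>.\<close>
  define R where "R = pcompose Q [:0, - 1:]"
  have poly_R: "poly R x = poly Q (- x)" for x
    by (simp add: R_def poly_pcompose)
  have "R \<noteq> 0"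
    using \<open>Q \<noteq> 0\<close> by (simp add: R_def pcompose_eq_0_iff)
  have fin: "finite {x. poly Q x = 0}"
    by (rule poly_roots_finite[OF \<open>Q \<noteq> 0\<close>])
  have "sign_alternations (map (coeff Q) ks) = sign_alternations (map (poly Q) (map y ks))"
    by (rule sign_alternations_cong_sgn)
      (auto simp: sgn_poly_dominant_at[OF y] y_pos sgn_mult less_imp_le)
  also have "\<dots> \<le> card {x. 0 < x \<and> poly Q x = 0}"
    using y_pos by (intro sign_alternations_le_card_roots sorted_y \<open>Q \<noteq> 0\<close>) auto
  finally have 1: "sign_alternations (map (coeff Q) ks) \<le> card {x. 0 < x \<and> poly Q x = 0}" .
  have "sgn ((- 1) ^ k * coeff Q k) = sgn (poly R (y k))" if "k \<in> set ks" for k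
  proof -
    have "sgn (poly R (y k)) = sgn (coeff Q k * (- y k) ^ k)"
      unfolding poly_R using y_pos[OF that] by (intro sgn_poly_dominant_at[OF y[OF that]]) simp
    also have "(- y k) ^ k = (- 1) ^ k * y k ^ k"
      by (rule power_minus)
    finally show ?thesis using y_pos[OF that] by (simp add: sgn_mult mult_ac)
  qed
  then have "sign_alternations (map (\<lambda>k. (- 1) ^ k * coeff Q k) ks) =
      sign_alternations (map (poly R) (map y ks))"
    by (intro sign_alternations_cong_sgn) simp
  also have "\<dots> \<le> card {x. 0 < x \<and> poly R x = 0}"
    using y_pos by (intro sign_alternations_le_card_roots sorted_y \<open>R \<noteq> 0\<close>) auto
  also have "\<dots> = card {x. x < 0 \<and> poly Q x = 0}"
    by (rule bij_betw_same_card[of uminus], rule bij_betw_byWitness[where f' = uminus])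
      (auto simp: poly_R)
  finally have 2: "sign_alternations (map (\<lambda>k. (- 1) ^ k * coeff Q k) ks)
      \<le> card {x. x < 0 \<and> poly Q x = 0}" .
  have "card {x. 0 < x \<and> poly Q x = 0} + card {x. x < 0 \<and> poly Q x = 0} =
      card ({x. 0 < x \<and> poly Q x = 0} \<union> {x. x < 0 \<and> poly Q x = 0})"
    by (rule card_Un_disjoint[symmetric]) (auto intro: finite_subset[OF _ fin])
  also have "{x. 0 < x \<and> poly Q x = 0} \<union> {x. x < 0 \<and> poly Q x = 0} = {x. x \<noteq> 0 \<and> poly Q x = 0}"
    by auto
  finally show ?thesis
    using 1 2 card_nonzero_roots_le[OF \<open>Q \<noteq> 0\<close>] by linarith
qed

section \<open>Convexity of \<open>k powr \<alpha> - k\<^sup>2\<close>\<close>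

text \<open>Bernoulli's inequality for a real exponent \<open>\<beta> \<ge> 1\<close>.\<close>
lemma powr_ge_tangent:
  fixes u \<beta> :: real
  assumes "0 \<le> u" "1 \<le> \<beta>"
  shows "1 + \<beta> * (u - 1) \<le> u powr \<beta>"
proof (cases "u = 0")
  case False
  then have u: "u > 0" using assms by simp
  have "ln (1 / u) \<le> 1 / u - 1"
    using u by (intro ln_le_minus_one) simp
  then have "1 - 1 / u \<le> ln u"
    using u by (simp add: ln_div)
  then have "1 + (\<beta> - 1) * (1 - 1 / u) \<le> 1 + (\<beta> - 1) * ln u"
    using assms by (intro add_left_mono mult_left_mono) auto
  also have "\<dots> \<le> exp ((\<beta> - 1) * ln u)"
    by (rule exp_ge_add_one_self)
  also have "\<dots> = u powr (\<beta> - 1)"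
    using u by (simp add: powr_def)
  finally have "u * (1 + (\<beta> - 1) * (1 - 1 / u)) \<le> u * u powr (\<beta> - 1)"
    using u by (intro mult_left_mono) auto
  moreover have "u * u powr (\<beta> - 1) = u powr \<beta>"
    using u by (simp add: powr_mult_base)
  moreover have "u * (1 + (\<beta> - 1) * (1 - 1 / u)) = 1 + \<beta> * (u - 1)"
    using u by (simp add: field_simps)
  ultimately show ?thesis by simp
qed (use assms in simp)

text \<open>
  With \<open>n = k + 1\<close>, \<open>h = 1/n\<close> and \<open>\<beta> = \<alpha>/3\<close>, Bernoulli's inequality applied to the cubes
  \<open>(1 \<plusminus> h)^3\<close> reduces the claim to the exponent \<open>3\<close>, where the second difference is explicit:
  \<open>(1 + h)^3 + (1 - h)^3 - 2 = 6 h^2\<close>.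
\<close>
lemma second_difference_powr_ge:
  fixes \<alpha> :: real
  assumes "3 \<le> \<alpha>"
  shows "6 \<le> real (k + 2) powr \<alpha> - 2 * real (k + 1) powr \<alpha> + real k powr \<alpha>"
proof -
  define n \<beta> h where "n = real (k + 1)" and "\<beta> = \<alpha> / 3" and "h = 1 / n"
  have n: "1 \<le> n" and h: "0 < h" "h \<le> 1" and \<beta>: "1 \<le> \<beta>"
    using assms by (auto simp: n_def \<beta>_def h_def)
  have cube: "n powr \<alpha> * (1 + \<beta> * (u ^ 3 - 1)) \<le> (n * u) powr \<alpha>" if "0 \<le> u" for u :: real
  proof -
    have "1 + \<beta> * (u ^ 3 - 1) \<le> (u ^ 3) powr \<beta>"
      using that \<beta> by (intro powr_ge_tangent) auto
    also have "(u ^ 3) powr \<beta> = u powr \<alpha>"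
      using that by (cases "u = 0") (simp_all add: \<beta>_def powr_powr flip: powr_numeral)
    finally have "n powr \<alpha> * (1 + \<beta> * (u ^ 3 - 1)) \<le> n powr \<alpha> * u powr \<alpha>"
      by (intro mult_left_mono) auto
    also have "\<dots> = (n * u) powr \<alpha>"
      using n that by (simp add: powr_mult)
    finally show ?thesis .
  qed
  have "6 = 6 * (n ^ 2 * h ^ 2)"
    using n by (simp add: h_def power_divide)
  also have "\<dots> \<le> n powr \<alpha> * (\<beta> * (6 * h ^ 2))"
  proof -
    have "n ^ 2 = n powr 2"
      using n by simp
    also have "\<dots> \<le> n powr \<alpha>"
      using n assms by (intro powr_mono) auto
    also have "\<dots> \<le> n powr \<alpha> * \<beta>"
      using mult_left_mono[OF \<beta>, of "n powr \<alpha>"] by simp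
    finally have "n ^ 2 * (6 * h ^ 2) \<le> n powr \<alpha> * \<beta> * (6 * h ^ 2)"
      by (intro mult_right_mono) auto
    then show ?thesis by (simp add: mult_ac)
  qed
  also have "\<dots> = n powr \<alpha> * (1 + \<beta> * ((1 + h) ^ 3 - 1)) + n powr \<alpha> * (1 + \<beta> * ((1 - h) ^ 3 - 1))
      - 2 * n powr \<alpha>"
    by (simp add: algebra_simps power3_eq_cube power2_eq_square)
  also have "\<dots> \<le> (n * (1 + h)) powr \<alpha> + (n * (1 - h)) powr \<alpha> - 2 * n powr \<alpha>"
    using h by (intro diff_right_mono add_mono cube) auto
  also have "n * (1 + h) = n + 1"
    using n by (simp add: h_def distrib_left)
  also have "\<dots> = real (k + 2)"
    by (simp add: n_def)
  also have "n * (1 - h) = n - 1"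
    using n by (simp add: h_def right_diff_distrib)
  also have "\<dots> = real k"
    by (simp add: n_def)
  finally show ?thesis by (simp add: n_def)
qed

text \<open>
  The slope \<open>s = f(k + 1) - f(k) - 2\<close> lies at least \<open>2\<close> below every increment of \<open>f\<close> from \<open>k\<close> on
  and at least \<open>2\<close> above every increment before \<open>k\<close>.
\<close>
lemma strongly_convex_seq_support_line:
  fixes f :: "nat \<Rightarrow> real"
  assumes conv: "\<And>k. f (k + 2) - 2 * f (k + 1) + f k \<ge> 4"
  shows "f k + (f (k + 1) - f k - 2) * (real i - real k) + 2 * \<bar>real i - real k\<bar> \<le> f i"
proof -
  define g where "g = (\<lambda>n. f (Suc n) - f n)"
  have step: "g n + 4 \<le> g (Suc n)" for n
    using conv[of n] by (simp add: g_def)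
  have mono: "g m \<le> g n" if "m \<le> n" for m n
  proof (rule lift_Suc_mono_le[OF _ that])
    show "g n \<le> g (Suc n)" for n using step[of n] by simp
  qed
  show ?thesis
  proof (cases "k \<le> i")
    case True
    have "f k + g k * (real i - real k) \<le> f i"
      using True
    proof (induction i rule: dec_induct)
      case (step n)
      show ?case using step.IH mono[OF step.hyps(1)] by (simp add: g_def algebra_simps)
    qed simp
    then show ?thesis using True by (simp add: g_def algebra_simps)
  next
    case False
    then have "i \<le> k" by simp
    then have "f k + (g k - 4) * (real i - real k) \<le> f i"
    proof (induction i rule: inc_induct)
      case (step n)
      have "g n \<le> g k - 4"
        using mono[of "Suc n" k] step.hyps \<open>\<And>n. g n + 4 \<le> g (Suc n)\<close>[of n] by simp
      then show ?case using step.IH by (simp add: g_def algebra_simps)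
    qed simp
    then show ?thesis using False by (simp add: g_def algebra_simps)
  qed
qed

lemma sum_exp_neg_dist_less_1:
  assumes "k \<le> d"
  shows "(\<Sum>i\<in>{..d} - {k}. exp (- 2 * \<bar>real i - real k\<bar>)) < 1"
proof -
  have "2 \<le> exp (1 :: real)"
    using exp_ge_add_one_self[of 1] by simp
  then have "2 * 2 \<le> exp 1 * exp (1 :: real)"
    by (intro mult_mono) auto
  then have "exp (- 2 :: real) \<le> 1 / 4"
    by (simp add: exp_minus field_simps flip: exp_add)
  then have quarter: "exp (- 2 * real j) \<le> (1 / 4) ^ j" for j
    using power_mono[of "exp (- 2 :: real)" "1 / 4" j] exp_of_nat_mult[of j "- 2 :: real"]
    by (simp add: mult.commute)
  have geo: "(\<Sum>j<n. (1 / 4) ^ Suc j) < (1 / 2 :: real)" for n :: nat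
  proof -
    have "(\<Sum>j<n. (1 / 4) ^ Suc j) = (1 - (1 / 4) ^ n) / (3 :: real)"
      by (induction n) (simp_all add: diff_divide_distrib)
    also have "\<dots> \<le> 1 / 3" by simp
    also have "\<dots> < 1 / 2" by simp
    finally show ?thesis .
  qed
  have "(\<Sum>i\<in>{..d} - {k}. exp (- 2 * \<bar>real i - real k\<bar>)) =
      (\<Sum>i<k. exp (- 2 * \<bar>real i - real k\<bar>)) + (\<Sum>i\<in>{k<..d}. exp (- 2 * \<bar>real i - real k\<bar>))"
    using assms by (subst sum.union_disjoint[symmetric]) (auto intro!: sum.cong)
  also have "(\<Sum>i<k. exp (- 2 * \<bar>real i - real k\<bar>)) = (\<Sum>j<k. exp (- 2 * real (Suc j)))"
    by (rule sum.reindex_bij_witness[where i = "\<lambda>j. k - Suc j" and j = "\<lambda>i. k - Suc i"]) auto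
  also have "\<dots> \<le> (\<Sum>j<k. (1 / 4) ^ Suc j)"
    by (intro sum_mono quarter)
  also have "(\<Sum>i\<in>{k<..d}. exp (- 2 * \<bar>real i - real k\<bar>)) = (\<Sum>j<d - k. exp (- 2 * real (Suc j)))"
    by (rule sum.reindex_bij_witness[where i = "\<lambda>j. k + Suc j" and j = "\<lambda>i. i - Suc k"]) auto
  also have "\<dots> \<le> (\<Sum>j<d - k. (1 / 4) ^ Suc j)"
    by (intro sum_mono quarter)
  also have "(\<Sum>j<k. (1 / 4) ^ Suc j) + (\<Sum>j<d - k. (1 / 4) ^ Suc j) < 1 / 2 + (1 / 2 :: real)"
    by (intro add_strict_mono geo)
  finally show ?thesis by simp
qed

section \<open>From tropical indices to dominant monomials\<close>

text \<open>
  Multiplying the weights \<open>lam\<close> by \<open>e^(-f(k))\<close> with \<open>f\<close> sufficiently convex turns tropical dominance,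
  which is over each single term, into dominance over the sum of all other terms.
\<close>
lemma tropical_index_dominant_at:
  fixes f :: "nat \<Rightarrow> real"
  assumes conv: "\<And>k. f (k + 2) - 2 * f (k + 1) + f k \<ge> 4"
    and lam_pos: "\<And>k. lam k > 0"
    and Q: "\<And>k. coeff Q k = lam k * exp (- f k) * coeff P k"
    and deg: "degree Q = degree P" and "P \<noteq> 0"
    and k: "k \<in> tropical_indices lam P"
  shows "\<exists>y. dominant_at Q k y"
proof -
  from k obtain x where x: "x > 0" and k_le: "k \<le> degree P"
    and trop: "\<And>i. i \<le> degree P \<Longrightarrow> i \<noteq> k \<Longrightarrow>
      lam i * \<bar>coeff P i\<bar> * x ^ i \<le> lam k * \<bar>coeff P k\<bar> * x ^ k"
    unfolding tropical_indices_def by auto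
  \<comment> \<open>Rescaling \<open>x\<close> by \<open>e^s\<close> adds \<open>s i\<close> to the exponent \<open>- f(i)\<close> of the \<open>i\<close>-th weight, where \<open>s\<close> is
    the slope of the line supporting \<open>f\<close> at \<open>k\<close>.\<close>
  define s where "s = f (k + 1) - f k - 2"
  define y where "y = x * exp s"
  have y: "y > 0" using x by (simp add: y_def)
  have term_eq: "\<bar>coeff Q i\<bar> * y ^ i = lam i * \<bar>coeff P i\<bar> * x ^ i * exp (s * real i - f i)" for i
  proof -
    have "exp (s * real i - f i) = exp (- f i) * exp s ^ i"
      by (simp add: exp_diff exp_minus exp_of_nat2_mult divide_inverse)
    then show ?thesis
      using lam_pos[of i] by (simp add: Q y_def abs_mult power_mult_distrib)
  qed
  have term_le: "\<bar>coeff Q i\<bar> * y ^ i \<le> \<bar>coeff Q k\<bar> * y ^ k * exp (- 2 * \<bar>real i - real k\<bar>)"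
    if "i \<in> {..degree Q} - {k}" for i
  proof -
    have "s * real i - f i \<le> (s * real k - f k) + (- 2 * \<bar>real i - real k\<bar>)"
      using strongly_convex_seq_support_line[of f, OF conv, of k i]
      by (simp add: s_def algebra_simps)
    then have "exp (s * real i - f i) \<le> exp (s * real k - f k) * exp (- 2 * \<bar>real i - real k\<bar>)"
      by (simp flip: exp_add)
    then have "lam i * \<bar>coeff P i\<bar> * x ^ i * exp (s * real i - f i) \<le>
        lam k * \<bar>coeff P k\<bar> * x ^ k * (exp (s * real k - f k) * exp (- 2 * \<bar>real i - real k\<bar>))"
      using that trop[of i] deg lam_pos[of k] x by (intro mult_mono[OF trop]) auto
    then show ?thesis unfolding term_eq by (simp add: mult_ac)
  qed
  have "coeff P k \<noteq> 0"
    using coeff_tropical_index_neq_0[OF \<open>P \<noteq> 0\<close> _ k] lam_pos by blast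
  then have pos: "0 < \<bar>coeff Q k\<bar> * y ^ k"
    using y lam_pos[of k] by (simp add: Q)
  have "(\<Sum>i\<in>{..degree Q} - {k}. \<bar>coeff Q i\<bar> * y ^ i) \<le>
      (\<Sum>i\<in>{..degree Q} - {k}. \<bar>coeff Q k\<bar> * y ^ k * exp (- 2 * \<bar>real i - real k\<bar>))"
    by (intro sum_mono term_le)
  also have "\<dots> = \<bar>coeff Q k\<bar> * y ^ k * (\<Sum>i\<in>{..degree Q} - {k}. exp (- 2 * \<bar>real i - real k\<bar>))"
    by (simp add: sum_distrib_left)
  also have "\<dots> < \<bar>coeff Q k\<bar> * y ^ k * 1"
    using k_le deg by (intro mult_strict_left_mono pos sum_exp_neg_dist_less_1) simp
  finally show ?thesis
    using y k_le deg unfolding dominant_at_def by auto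
qed

lemma num_essential_tropical_roots_le:
  fixes f :: "nat \<Rightarrow> real"
  assumes conv: "\<And>k. f (k + 2) - 2 * f (k + 1) + f k \<ge> 4"
    and lam_pos: "\<And>k. lam k > 0"
    and Q: "\<And>k. coeff Q k = lam k * exp (- f k) * coeff P k"
    and deg: "degree Q = degree P" and "P \<noteq> 0"
  shows "num_essential_tropical_roots lam P \<le> num_nonzero_real_roots Q"
proof -
  define ks where "ks = sorted_list_of_set (tropical_indices lam P)"
  have set_ks: "set ks = tropical_indices lam P"
    by (simp add: ks_def finite_tropical_indices)
  have "sgn (coeff Q k) = sgn (coeff P k)" for k
    using lam_pos[of k] by (simp add: Q sgn_mult)
  then have "num_essential_tropical_roots lam P = sign_alternations (map (coeff Q) ks) +
      sign_alternations (map (\<lambda>k. (- 1) ^ k * coeff Q k) ks)"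
    unfolding num_essential_tropical_roots_def Let_def ks_def[symmetric]
    by (intro arg_cong2[where f = "(+)"] sign_alternations_cong_sgn) (simp_all add: sgn_mult)
  moreover have "Q \<noteq> 0"
    using Q[of "degree P"] lam_pos[of "degree P"] \<open>P \<noteq> 0\<close> by auto
  ultimately show ?thesis
    using alternations_le_num_nonzero_real_roots[of Q ks] tropical_index_dominant_at[OF assms]
      strict_sorted_list_of_set[of "tropical_indices lam P"]
    by (simp add: set_ks ks_def[symmetric])
qed

lemma order_0_cong:
  fixes P Q :: "real poly"
  assumes "\<And>k. coeff Q k = 0 \<longleftrightarrow> coeff P k = 0" "P \<noteq> 0"
  shows "order 0 Q = order 0 P"
proof -
  have "Q \<noteq> 0" using assms by (metis coeff_0 poly_eqI)
  have "n \<le> order 0 Q \<longleftrightarrow> n \<le> order 0 P" for n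
    using monom_1_dvd_iff[OF \<open>Q \<noteq> 0\<close>, of n] monom_1_dvd_iff[OF \<open>P \<noteq> 0\<close>, of n]
    by (simp add: monom_1_dvd_iff' assms(1))
  then show ?thesis by (metis order_antisym order_refl)
qed

theorem theorem33:
  fixes \<alpha> :: real
  assumes "\<forall>d>0. real_to_tropical_root_preserver d (\<lambda>k. exp (- (real k ^ 2)))"
    and "\<alpha> \<ge> 3"
  shows "czds (\<lambda>k. exp (- (real k powr \<alpha>)))"
proof -
  define lam where "lam = (\<lambda>k::nat. exp (- (real k ^ 2)))"
  define f where "f = (\<lambda>k::nat. real k powr \<alpha> - real k ^ 2)"
  have conv: "f (k + 2) - 2 * f (k + 1) + f k \<ge> 4" for k
    using second_difference_powr_ge[OF assms(2), of k]
    by (simp add: f_def power2_eq_square algebra_simps)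
  have "num_nonreal_roots (\<Sum>k\<le>d. monom (exp (- (real k powr \<alpha>)) * coeff P k) k)
      \<le> num_nonreal_roots P" if "degree P \<le> d" for d P
  proof (cases "P = 0")
    case False
    define Q where "Q = (\<Sum>k\<le>d. monom (exp (- (real k powr \<alpha>)) * coeff P k) k)"
    have coeff_Q: "coeff Q k = exp (- (real k powr \<alpha>)) * coeff P k" for k
      using that by (auto simp: Q_def coeff_sum coeff_eq_0)
    have Q_lam: "coeff Q k = lam k * exp (- f k) * coeff P k" for k
      by (simp add: coeff_Q lam_def f_def flip: exp_add)
    have Q_0_iff: "coeff Q k = 0 \<longleftrightarrow> coeff P k = 0" for k
      by (simp add: coeff_Q)
    have deg: "degree Q = degree P"
      by (simp add: degree_def Q_0_iff)
    have "Q \<noteq> 0"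
      using False Q_0_iff by (metis coeff_0 poly_eqI)
    note nonreal = num_nonreal_roots_add_size_proots[OF False]
      num_nonreal_roots_add_size_proots[OF \<open>Q \<noteq> 0\<close>]
    have "num_nonreal_roots Q \<le> num_nonreal_roots P"
    proof (cases "degree P = 0")
      \<comment> \<open>The hypothesis concerns positive degrees only; constants have no roots to count.\<close>
      case True
      then show ?thesis using nonreal deg by simp
    next
      case pos: False
      then have "num_nonzero_real_roots P \<le> num_essential_tropical_roots lam P"
        using assms(1) False unfolding real_to_tropical_root_preserver_def lam_def by blast
      also have "\<dots> \<le> num_nonzero_real_roots Q"
        by (rule num_essential_tropical_roots_le[OF conv _ Q_lam deg False]) (simp add: lam_def)
      finally show ?thesis
        using nonreal deg order_0_cong[OF Q_0_iff False]
          size_proots_eq_order_0[OF False] size_proots_eq_order_0[OF \<open>Q \<noteq> 0\<close>] by linarith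
    qed
    then show ?thesis by (simp add: Q_def)
  qed simp
  then show ?thesis by (simp add: czds_def czds_in_degree_def)
qed

end
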